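(* There exists an absolute constant $C>0$ such that the following holds. Let $n$ be a positive integer, let $\mathcal{A},\mathcal{B}\subseteq 2^{[n]}$ be nonempty families with $d(\mathcal{A},\mathcal{B})\geq\delta$ for some $\delta\in(0,1-\frac1n)$. Then there exist subfamilies $\mathcal{R}\subseteq\mathcal{A}$ and $\mathcal{S}\subseteq\mathcal{B}$ such that $R\cap S=\varnothing$ for every $R\in\mathcal{R}$, $S\in\mathcal{S}$, and $$|\mathcal{R}||\mathcal{S}|\geq 2^{-C\sqrt{n\log_2(1/\delta)}}|\mathcal{A}||\mathcal{B}|.$$
   Context: For families $\mathcal{A},\mathcal{B}\subseteq 2^{[n]}$, $d(\mathcal{A},\mathcal{B})=N/(|\mathcal{A}||\mathcal{B}|)$ where $N$ is the number of pairs $(A,B)\in\mathcal{A}\times\mathcal{B}$ with $A\cap B=\varnothing$. *)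

theory Defs
  imports Complex_Main
begin

definition disjoint_density :: "'a set set \<Rightarrow> 'a set set \<Rightarrow> real" where
  "disjoint_density \<A> \<B> =
     real (card {(A, B). A \<in> \<A> \<and> B \<in> \<B> \<and> A \<inter> B = {}}) / (real (card \<A>) * real (card \<B>))"

end

theory Submission imports Defs begin

text \<open>
  The core is a covering estimate: if \<open>x, A\<^sub>1, \<dots>, A\<^sub>N\<close> with \<open>N = 2t + 1\<close> are drawn uniformly and
  independently from a family of subsets of an \<open>n\<close>-set, then \<open>x \<subseteq> A\<^sub>1 \<union> \<dots> \<union> A\<^sub>N\<close> with probability
  at least \<open>2 powr (-O(n / t))\<close>.  Applying it to \<open>{A \<in> \<A>. A \<inter> B = {}}\<close> and averaging over
  \<open>B \<in> \<B>\<close> (Jensen turns the density into a factor \<open>\<delta> ^ (2t + 2)\<close>) yields a tuple whose union \<open>U\<close>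
  works: take \<open>\<R>\<close> to be the members of \<open>\<A>\<close> inside \<open>U\<close> and \<open>\<S>\<close> the members of \<open>\<B>\<close> disjoint
  from \<open>U\<close>.  The choice \<open>t \<approx> sqrt (n / log 2 (1 / \<delta>))\<close> balances the two losses.

  For the covering estimate, let \<open>p M\<close> be the probability that a random member contains \<open>M\<close>.
  Since the mean over \<open>x\<close> of \<open>\<Sum>M. 1 / p M\<close>, over \<open>b\<close>-subsets \<open>M\<close> of \<open>x\<close>, is at most \<open>n choose b\<close>,
  Markov's inequality makes at least half of the \<open>x\<close> good at all levels \<open>b\<close> simultaneously.  For a
  good \<open>x\<close>, level \<open>b = 1\<close> shows that \<open>t\<close> members typically cover \<open>x\<close> up to a set \<open>W\<close> of size
  \<open>O(n / t)\<close>.  That remainder is covered by further members through exponential tilting: with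
  weight \<open>\<lambda> ^ card (W \<inter> A)\<close>, \<open>\<lambda> = (1 + a / card W)\<^sup>2\<close> and \<open>a\<close> of order \<open>n / t\<close>, the potential
  \<open>1 / cost a (card W)\<close> grows by a factor \<open>exp \<rho>\<close> per step, \<open>\<rho> = 400 n / t\<^sup>2\<close>, whereas the total
  price of the tilts is only \<open>cost a (card W) = exp (O(n / t))\<close>.  A remainder of size at most
  \<open>\<rho>\<close> is contained in a single member with sufficient probability.
\<close>

section \<open>Elementary inequalities\<close>

lemma card_filter_add_card_filter_not:
  assumes "finite A"
  shows "card {x \<in> A. P x} + card {x \<in> A. \<not> P x} = card A"
  using assms by (subst card_Un_disjoint[symmetric]) (auto intro!: arg_cong[where f = card])

text \<open>A single term of the series for \<open>exp b\<close> gives b^b / b! \<le> e^b, and e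
  \<le> 3.\<close>

lemma power_div_3_le_fact: "(real b / 3) ^ b \<le> fact b"
proof -
  have s: "(\<lambda>n. real b ^ n /\<^sub>R fact n) sums exp (real b)"
    by (rule exp_converges)
  have "(\<Sum>n\<in>{b}. real b ^ n /\<^sub>R fact n) \<le> exp (real b)"
    unfolding sums_unique[OF s]
    by (rule sum_le_suminf) (use s in \<open>auto simp: sums_iff\<close>)
  hence "real b ^ b / fact b \<le> exp (real b)"
    by (simp add: field_simps)
  also have "exp (real b) = exp 1 ^ b"
    by (simp flip: exp_of_nat_mult)
  also have "\<dots> \<le> 3 ^ b"
    by (rule power_mono) (use exp_le in auto)
  finally show ?thesis
    by (simp add: field_simps power_divide)
qed

lemma power_tangent_le:
  fixes x y :: real
  assumes "x > 0" "y \<ge> 0"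
  shows "x ^ N + real N * x ^ N / x * (y - x) \<le> y ^ N"
proof -
  have "1 + real N * (y / x - 1) \<le> (1 + (y / x - 1)) ^ N"
    by (rule Bernoulli_inequality) (use assms in simp)
  hence "x ^ N * (1 + real N * (y / x - 1)) \<le> x ^ N * (y / x) ^ N"
    using assms by (intro mult_left_mono) auto
  also have "x ^ N * (y / x) ^ N = y ^ N"
    using assms by (simp add: power_divide)
  finally show ?thesis
    using assms by (simp add: field_simps)
qed

text \<open>Jensen's inequality for the N-th power: sum the tangent lines at \<delta>. Their linear
  parts add up to a nonnegative amount because the mean of \<open>d\<close> is at least
  \<delta>.\<close>

lemma sum_power_ge:
  fixes d :: "'a \<Rightarrow> real"
  assumes "finite S" "\<delta> > 0" "\<And>B. B \<in> S \<Longrightarrow> d B \<ge> 0" "(\<Sum>B\<in>S. d B) \<ge> \<delta> * real (card S)"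
  shows "(\<Sum>B\<in>S. d B ^ N) \<ge> \<delta> ^ N * real (card S)"
proof -
  have "\<delta> ^ N * real (card S) \<le>
      \<delta> ^ N * real (card S) + real N * \<delta> ^ N / \<delta> * ((\<Sum>B\<in>S. d B) - \<delta> * real (card S))"
    using assms by simp
  also have "\<dots> = (\<Sum>B\<in>S. \<delta> ^ N + real N * \<delta> ^ N / \<delta> * (d B - \<delta>))"
    by (subst sum.distrib, subst sum_distrib_left[symmetric]) (simp add: sum_subtractf mult.commute)
  also have "\<dots> \<le> (\<Sum>B\<in>S. d B ^ N)"
    using assms by (intro sum_mono power_tangent_le) auto
  finally show ?thesis .
qed

lemma card_sq_le_sum_mult_sum_inverse:
  fixes p :: "'a \<Rightarrow> real"
  assumes "finite S" "\<And>x. x \<in> S \<Longrightarrow> p x > 0"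
  shows "real (card S) ^ 2 \<le> (\<Sum>x\<in>S. p x) * (\<Sum>x\<in>S. 1 / p x)"
proof (cases "S = {}")
  case False
  define T where "T = (\<Sum>x\<in>S. 1 / p x)"
  \<comment> \<open>This \<open>c\<close> maximises the lower bound 2 c |S| - c^2 T, obtained by
    summing (p x - c)^2 \<ge> 0 divided by p x.\<close>
  define c where "c = real (card S) / T"
  have T: "T > 0"
    unfolding T_def using assms False by (intro sum_pos) auto
  have "(\<Sum>x\<in>S. 2 * c - c ^ 2 / p x) \<le> (\<Sum>x\<in>S. p x)"
  proof (rule sum_mono)
    fix x assume x: "x \<in> S"
    have "0 \<le> (p x - c) ^ 2" by simp
    thus "2 * c - c ^ 2 / p x \<le> p x"
      using assms(2)[OF x] by (simp add: field_simps power2_eq_square)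
  qed
  also have "(\<Sum>x\<in>S. 2 * c - c ^ 2 / p x) = 2 * c * card S - c ^ 2 * T"
    by (simp add: sum_subtractf T_def sum_distrib_left)
  also have "\<dots> = real (card S) ^ 2 / T"
    using T by (simp add: c_def power2_eq_square field_simps)
  finally show ?thesis
    using T by (simp add: T_def field_simps)
qed simp

text \<open>Supplies the growth factor per draw in \<open>mean_inverse_cost_ge\<close>. For \<rho> <
  1 the level is b = 1 and a linear bound on exp suffices. Otherwise b \<le> 2 \<rho>, so a^2 \<ge>
  72 n \<rho> \<ge> 36 n b. With b! \<ge> (b/3)^b the power is then at least 6^b, and 6^b / 2 \<ge>
  3^b \<ge> exp \<rho>.\<close>

lemma exp_le_growth:
  fixes \<rho> a :: real
  assumes "n > 0" "\<rho> \<ge> 0" "a \<ge> 0" and a: "a ^ 2 \<ge> 72 * real n * \<rho>"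
    and b: "b = Suc (nat \<lfloor>\<rho>\<rfloor>)"
  shows "exp \<rho> \<le> 1 + (a ^ 2 / (2 * real n * real b ^ 2)) ^ b * fact b / 2"
proof (cases "\<rho> < 1")
  case True
  hence "\<lfloor>\<rho>\<rfloor> = 0" using assms by linarith
  hence [simp]: "b = 1" by (simp add: b)
  have "exp \<rho> \<le> 1 + \<rho> + \<rho> ^ 2"
    using True assms by (intro exp_bound) auto
  also have "\<dots> \<le> 1 + 2 * \<rho>"
    using True assms mult_left_le[of \<rho> \<rho>] by (simp add: power2_eq_square)
  also have "\<dots> \<le> 1 + a ^ 2 / (4 * real n)"
  proof -
    have "8 * real n * \<rho> \<le> 72 * real n * \<rho>"
      using assms by (intro mult_right_mono) auto
    also have "8 * real n * \<rho> = 2 * \<rho> * (4 * real n)" by simp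
    also note a
    finally have "2 * \<rho> * (4 * real n) \<le> a ^ 2" .
    thus ?thesis using assms by (subst add_le_cancel_left, subst pos_le_divide_eq) auto
  qed
  finally show ?thesis by simp
next
  case False
  have b0: "real b > 0" by (simp add: b)
  have b1: "real b \<le> 2 * \<rho>" and b2: "\<rho> \<le> real b"
    using False by (auto simp: b of_nat_nat) linarith+
  have "exp \<rho> \<le> exp (real b)" using b2 by simp
  also have "\<dots> = exp 1 ^ b" by (simp flip: exp_of_nat_mult)
  also have "\<dots> \<le> 3 ^ b"
    by (rule power_mono) (use exp_le in auto)
  also have "\<dots> \<le> (6::real) ^ b / 2"
  proof -
    have "(6::real) ^ b = 3 ^ b * 2 ^ b" by (simp flip: power_mult_distrib)
    moreover have "(2::real) ^ b \<ge> 2 ^ 1" by (rule power_increasing) (auto simp: b)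
    ultimately show ?thesis by simp
  qed
  also have "(6::real) ^ b \<le> ((a ^ 2 / (2 * real n * real b ^ 2)) * (real b / 3)) ^ b"
  proof (rule power_mono)
    have "36 * real n * real b \<le> 36 * real n * (2 * \<rho>)"
      using b1 by (intro mult_left_mono) auto
    also have "\<dots> = 72 * real n * \<rho>" by simp
    also note a
    finally have "36 * real n * real b \<le> a ^ 2" .
    thus "6 \<le> (a ^ 2 / (2 * real n * real b ^ 2)) * (real b / 3)"
      using b0 assms(1) by (simp add: field_simps power2_eq_square)
  qed simp
  also have "\<dots> = (a ^ 2 / (2 * real n * real b ^ 2)) ^ b * (real b / 3) ^ b"
    by (simp only: power_mult_distrib)
  also have "\<dots> \<le> (a ^ 2 / (2 * real n * real b ^ 2)) ^ b * fact b"
    by (intro mult_left_mono power_div_3_le_fact) auto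
  finally show ?thesis by simp
qed

section \<open>Covering probabilities\<close>

text \<open>The probability that \<open>W\<close> lies in the union of \<open>r\<close> independent uniform members of \<open>F\<close>.\<close>

primrec cover_prob :: "'a set set \<Rightarrow> nat \<Rightarrow> 'a set \<Rightarrow> real" where
  "cover_prob F 0 W = of_bool (W = {})"
| "cover_prob F (Suc r) W = (\<Sum>A\<in>F. cover_prob F r (W - A)) / real (card F)"

abbreviation tuples :: "'a set set \<Rightarrow> nat \<Rightarrow> 'a set list set" where
  "tuples F r \<equiv> {xs. set xs \<subseteq> F \<and> length xs = r}"

lemma sum_tuples_Suc:
  "(\<Sum>xs\<in>tuples F (Suc r). f xs) = (\<Sum>A\<in>F. \<Sum>xs\<in>tuples F r. f (A # xs))"
proof -
  have "(\<Sum>xs\<in>tuples F (Suc r). f xs) = (\<Sum>(xs, A)\<in>tuples F r \<times> F. f (A # xs))"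
    unfolding lists_length_Suc_eq
    by (subst sum.reindex) (auto simp: inj_on_def case_prod_unfold)
  also have "\<dots> = (\<Sum>xs\<in>tuples F r. \<Sum>A\<in>F. f (A # xs))"
    by (simp add: sum.cartesian_product)
  also have "\<dots> = (\<Sum>A\<in>F. \<Sum>xs\<in>tuples F r. f (A # xs))"
    by (rule sum.swap)
  finally show ?thesis .
qed

lemma cover_prob_nonneg: "cover_prob F r W \<ge> 0"
  by (induction r arbitrary: W) (auto intro!: divide_nonneg_nonneg sum_nonneg)

text \<open>Condition on the first \<open>s\<close> draws; the other \<open>r\<close> have to cover
  what these leave.\<close>

lemma cover_prob_add:
  assumes "finite F" "F \<noteq> {}"
  shows "cover_prob F (s + r) W * real (card F) ^ s
    = (\<Sum>xs\<in>tuples F s. cover_prob F r (W - \<Union>(set xs)))"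
proof (induction s arbitrary: W)
  case 0
  have "{xs. xs = [] \<and> set xs \<subseteq> F} = {[]}" by auto
  thus ?case by (simp add: conj_commute)
next
  case (Suc s)
  have "cover_prob F (Suc s + r) W * real (card F) ^ Suc s
      = (\<Sum>A\<in>F. cover_prob F (s + r) (W - A) * real (card F) ^ s)"
    using assms by (simp add: sum_distrib_right[symmetric])
  also have "\<dots> = (\<Sum>A\<in>F. \<Sum>xs\<in>tuples F s. cover_prob F r (W - A - \<Union>(set xs)))"
    by (simp only: Suc.IH)
  also have "\<dots> = (\<Sum>xs\<in>tuples F (Suc s). cover_prob F r (W - \<Union>(set xs)))"
    unfolding sum_tuples_Suc by (simp add: Diff_eq Int_assoc)
  finally show ?case .
qed

lemma cover_prob_eq_card:
  assumes "finite F" "F \<noteq> {}"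
  shows "cover_prob F r W * real (card F) ^ r
    = real (card {xs \<in> tuples F r. W \<subseteq> \<Union>(set xs)})"
proof -
  have "cover_prob F r W * real (card F) ^ r = (\<Sum>xs\<in>tuples F r. of_bool (W \<subseteq> \<Union>(set xs)))"
    using cover_prob_add[OF assms, of r 0 W] by simp
  also have "\<dots> = real (card {xs \<in> tuples F r. W \<subseteq> \<Union>(set xs)})"
    using finite_lists_length_eq[OF assms(1), of r]
    by (subst sum_of_bool_eq) (auto simp: Int_def)
  finally show ?thesis .
qed

lemma cover_prob_empty:
  assumes "finite F" "F \<noteq> {}"
  shows "cover_prob F r {} = 1"
  using assms by (induction r) auto

section \<open>Containment probabilities and good members\<close>

locale set_family =
  fixes V :: "'a set" and F :: "'a set set"
  assumes finite_V: "finite V" and F_subset: "F \<subseteq> Pow V" and F_nonempty: "F \<noteq> {}"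
begin

lemma finite_F: "finite F"
  using F_subset finite_V by (meson finite_Pow_iff finite_subset)

lemma card_F_pos: "real (card F) > 0"
  using finite_F F_nonempty by (simp add: card_gt_0_iff)

lemma finite_mem: "x \<in> F \<Longrightarrow> finite x"
  using F_subset finite_V by (meson PowD finite_subset subsetD)

lemma subset_V: "x \<in> F \<Longrightarrow> W \<subseteq> x \<Longrightarrow> W \<subseteq> V"
  using F_subset by auto

definition p :: "'a set \<Rightarrow> real" where
  "p M = real (card {A \<in> F. M \<subseteq> A}) / real (card F)"

definition inv_sum :: "nat \<Rightarrow> 'a set \<Rightarrow> real" where
  "inv_sum b x = (\<Sum>M | M \<subseteq> x \<and> card M = b. 1 / p M)"

text \<open>The level-b threshold is 2^(b+1) times the bound on the mean, so the failure
  probabilities given by Markov sum to less than 1/2 over all levels.\<close>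

definition good :: "'a set \<Rightarrow> bool" where
  "good x \<longleftrightarrow> (\<forall>b\<in>{1..card V}. inv_sum b x \<le> 2 ^ Suc b * real (card V choose b))"

lemma p_pos:
  assumes "x \<in> F" "M \<subseteq> x"
  shows "p M > 0"
proof -
  have "x \<in> {A \<in> F. M \<subseteq> A}" using assms by simp
  hence "card {A \<in> F. M \<subseteq> A} > 0" using finite_F by (auto simp: card_gt_0_iff)
  thus ?thesis using card_F_pos by (simp add: p_def)
qed

text \<open>It is enough that the first draw contains \<open>W\<close>.\<close>

lemma p_le_cover_prob: "p W \<le> cover_prob F (Suc r) W"
proof -
  have "real (card {A \<in> F. W \<subseteq> A}) = (\<Sum>A\<in>{A \<in> F. W \<subseteq> A}. cover_prob F r (W - A))"
  proof -
    have "(\<Sum>A\<in>{A \<in> F. W \<subseteq> A}. cover_prob F r (W - A)) = (\<Sum>A\<in>{A \<in> F. W \<subseteq> A}. 1)"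
      using cover_prob_empty[OF finite_F F_nonempty]
      by (intro sum.cong) (auto simp: Diff_eq_empty_iff[THEN iffD2])
    thus ?thesis by simp
  qed
  also have "\<dots> \<le> (\<Sum>A\<in>F. cover_prob F r (W - A))"
    by (rule sum_mono2) (use finite_F cover_prob_nonneg in auto)
  finally show ?thesis using card_F_pos by (simp add: p_def divide_right_mono)
qed

lemma sum_inv_sum_le: "(\<Sum>x\<in>F. inv_sum b x) \<le> real (card F) * real (card V choose b)"
proof -
  let ?S = "{M. M \<subseteq> V \<and> card M = b}"
  have fin: "finite ?S" using finite_V by simp
  have "(\<Sum>x\<in>F. inv_sum b x) = (\<Sum>x\<in>F. \<Sum>M | M \<in> ?S \<and> M \<subseteq> x. 1 / p M)"
    unfolding inv_sum_def using F_subset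
    by (intro sum.cong arg_cong2[where f = sum] refl) auto
  also have "\<dots> = (\<Sum>M\<in>?S. \<Sum>x | x \<in> F \<and> M \<subseteq> x. 1 / p M)"
    by (rule sum.swap_restrict[OF finite_F fin])
  \<comment> \<open>Exactly |F| p M members contain \<open>M\<close>, each contributing 1 / p M. If
    no member contains \<open>M\<close>, the inner sum is empty.\<close>
  also have "\<dots> \<le> (\<Sum>M\<in>?S. real (card F))"
    by (rule sum_mono) (auto simp: p_def)
  also have "\<dots> = real (card F) * real (card V choose b)"
    using n_subsets[OF finite_V, of b] by simp
  finally show ?thesis .
qed

lemma card_good_ge: "real (card {x \<in> F. good x}) \<ge> real (card F) / 2"
proof -
  let ?n = "card V"
  let ?B = "\<lambda>b. {x \<in> F. inv_sum b x > 2 ^ Suc b * real (?n choose b)}"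
  have B: "real (card (?B b)) \<le> real (card F) * (1 / 2) ^ Suc b" if b: "b \<in> {1..?n}" for b
  proof -
    have nonneg: "inv_sum b x \<ge> 0" for x
      unfolding inv_sum_def by (intro sum_nonneg) (auto simp: p_def)
    have "2 ^ Suc b * real (?n choose b) * real (card (?B b)) = (\<Sum>x\<in>?B b. 2 ^ Suc b * real (?n choose b))"
      by simp
    also have "\<dots> \<le> (\<Sum>x\<in>?B b. inv_sum b x)"
      by (rule sum_mono) auto
    also have "\<dots> \<le> (\<Sum>x\<in>F. inv_sum b x)"
      by (rule sum_mono2) (use finite_F nonneg in auto)
    also have "\<dots> \<le> real (card F) * real (?n choose b)"
      by (rule sum_inv_sum_le)
    finally have "real (?n choose b) * (2 ^ Suc b * real (card (?B b))) \<le> real (?n choose b) * real (card F)"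
      by (simp only: ac_simps)
    moreover have "real (?n choose b) > 0" using b by simp
    ultimately have "2 ^ Suc b * real (card (?B b)) \<le> real (card F)"
      by (simp only: mult_le_cancel_left_pos)
    thus ?thesis by (simp add: field_simps power_divide)
  qed
  have geo: "(\<Sum>b\<in>{1..m}. (1 / 2 :: real) ^ Suc b) = 1 / 2 - (1 / 2) ^ Suc m" for m
    by (induction m) auto
  have "{x \<in> F. \<not> good x} = (\<Union>b\<in>{1..?n}. ?B b)"
    by (auto simp: good_def not_le)
  hence "real (card {x \<in> F. \<not> good x}) \<le> (\<Sum>b\<in>{1..?n}. real (card (?B b)))"
    using card_UN_le[of "{1..?n}" ?B] by (simp flip: of_nat_sum)
  also have "\<dots> \<le> (\<Sum>b\<in>{1..?n}. real (card F) * (1 / 2) ^ Suc b)"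
    by (rule sum_mono) (rule B)
  also have "\<dots> \<le> real (card F) / 2"
    unfolding sum_distrib_left[symmetric] geo using card_F_pos by (simp add: field_simps)
  finally have "real (card {x \<in> F. \<not> good x}) \<le> real (card F) / 2" .
  moreover have "card {x \<in> F. good x} + card {x \<in> F. \<not> good x} = card F"
    by (rule card_filter_add_card_filter_not[OF finite_F])
  ultimately show ?thesis by simp
qed

text \<open>Cauchy-Schwarz over the b-subsets of \<open>W\<close>. The sum of 1 / p M over them is
  part of \<open>inv_sum b x\<close>, which goodness bounds.\<close>

lemma sum_p_ge:
  assumes "x \<in> F" "good x" "W \<subseteq> x" "1 \<le> b" "b \<le> card W"
  shows "real (card W choose b) ^ 2 / (2 ^ Suc b * real (card V choose b))
    \<le> (\<Sum>M | M \<subseteq> W \<and> card M = b. p M)"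
proof -
  let ?S = "{M. M \<subseteq> W \<and> card M = b}"
  have WV: "W \<subseteq> V" and finW: "finite W" and finx: "finite x"
    using subset_V[OF assms(1,3)] finite_subset[OF _ finite_V] finite_mem[OF assms(1)] by auto
  have b: "b \<le> card V" using assms(5) card_mono[OF finite_V WV] by simp
  have pos: "real (card V choose b) > 0" using b by simp
  have pM: "p M > 0" if "M \<subseteq> x" for M using p_pos[OF assms(1) that] .
  have "real (card W choose b) ^ 2 = real (card ?S) ^ 2"
    using n_subsets[OF finW, of b] by simp
  also have "\<dots> \<le> (\<Sum>M\<in>?S. p M) * (\<Sum>M\<in>?S. 1 / p M)"
    using finW assms(3) pM by (intro card_sq_le_sum_mult_sum_inverse) auto
  also have "\<dots> \<le> (\<Sum>M\<in>?S. p M) * inv_sum b x"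
    unfolding inv_sum_def using finx assms(3) pM
    by (intro mult_left_mono sum_mono2 sum_nonneg) (auto intro: less_imp_le)
  also have "\<dots> \<le> (\<Sum>M\<in>?S. p M) * (2 ^ Suc b * real (card V choose b))"
    using assms b pM by (intro mult_left_mono sum_nonneg) (auto simp: good_def intro: less_imp_le)
  finally show ?thesis using pos by (simp add: field_simps)
qed

text \<open>Since (1 + a/w)^2 \<ge> 1 + \<mu> with \<mu> = (a/w)^2, the binomial expansion may be
  cut down to its terms of order 0 and b. The mean of |W \<inter> A| choose b is the sum of p M over
  b-subsets of \<open>W\<close>, which \<open>sum_p_ge\<close> bounds. Scaling the tilt by 1/w makes
  w cancel against (w choose b)^2 \<ge> (w/b)^(2b).\<close>

lemma mean_power_card_Int_ge:
  assumes "x \<in> F" "good x" "W \<subseteq> x" "1 \<le> b" "b \<le> card W" "a \<ge> 0"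
  shows "1 + (a ^ 2 / (2 * real (card V) * real b ^ 2)) ^ b * fact b / 2
    \<le> (\<Sum>A\<in>F. ((1 + a / real (card W)) ^ 2) ^ card (W \<inter> A)) / real (card F)"
proof -
  let ?S = "{M. M \<subseteq> W \<and> card M = b}"
  let ?n = "card V" and ?w = "card W"
  define \<mu> where "\<mu> = (a / real ?w) ^ 2"
  have WV: "W \<subseteq> V" and finW: "finite W"
    using subset_V[OF assms(1,3)] finite_subset[OF _ finite_V] by auto
  have fin: "finite ?S" using finW by simp
  have b: "b \<le> ?n" using assms(5) card_mono[OF finite_V WV] by simp
  have w0: "?w > 0" and n0: "?n > 0" using assms b by auto
  have \<mu>: "\<mu> \<ge> 0" by (simp add: \<mu>_def)
  have "1 + \<mu> ^ b * (\<Sum>M\<in>?S. p M) = (\<Sum>A\<in>F. 1 + \<mu> ^ b * real (card (W \<inter> A) choose b)) / real (card F)"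
  proof -
    have "(\<Sum>M\<in>?S. real (card {A \<in> F. M \<subseteq> A})) = (\<Sum>M\<in>?S. \<Sum>A | A \<in> F \<and> M \<subseteq> A. 1)"
      by simp
    also have "\<dots> = (\<Sum>A\<in>F. \<Sum>M | M \<in> ?S \<and> M \<subseteq> A. 1)"
      by (rule sum.swap_restrict[OF fin finite_F])
    also have "\<dots> = (\<Sum>A\<in>F. real (card (W \<inter> A) choose b))"
    proof (rule sum.cong)
      fix A
      have "{M. M \<in> ?S \<and> M \<subseteq> A} = {M. M \<subseteq> W \<inter> A \<and> card M = b}" by auto
      thus "(\<Sum>M | M \<in> ?S \<and> M \<subseteq> A. 1) = real (card (W \<inter> A) choose b)"
        using n_subsets[of "W \<inter> A" b] finW by simp
    qed simp
    finally show ?thesis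
      using card_F_pos
      by (simp add: p_def sum.distrib sum_distrib_left[symmetric] sum_divide_distrib[symmetric] add_divide_distrib)
  qed
  also have "\<dots> \<le> (\<Sum>A\<in>F. ((1 + a / real ?w) ^ 2) ^ card (W \<inter> A)) / real (card F)"
  proof (intro divide_right_mono sum_mono)
    fix A
    let ?c = "card (W \<inter> A)"
    have "1 + \<mu> ^ b * real (?c choose b) \<le> (\<mu> + 1) ^ ?c"
    proof (cases "b \<le> ?c")
      case True
      have "(\<Sum>k\<in>{0, b}. real (?c choose k) * \<mu> ^ k) \<le> (\<Sum>k\<le>?c. real (?c choose k) * \<mu> ^ k * 1 ^ (?c - k))"
        using True \<mu> by (simp only: power_one mult_1_right) (rule sum_mono2, auto)
      thus ?thesis using assms(4) by (subst binomial_ring) (simp add: mult.commute)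
    next
      case False
      thus ?thesis using \<mu> by (simp add: binomial_eq_0)
    qed
    also have "\<dots> \<le> ((1 + a / real ?w) ^ 2) ^ ?c"
      using assms(6) by (intro power_mono) (auto simp: \<mu>_def power2_eq_square algebra_simps)
    finally show "1 + \<mu> ^ b * real (?c choose b) \<le> ((1 + a / real ?w) ^ 2) ^ ?c" .
  qed simp
  finally have main: "1 + \<mu> ^ b * (\<Sum>M\<in>?S. p M)
      \<le> (\<Sum>A\<in>F. ((1 + a / real ?w) ^ 2) ^ card (W \<inter> A)) / real (card F)" .
  have "(a ^ 2 / (2 * real ?n * real b ^ 2)) ^ b * fact b / 2
      = \<mu> ^ b * (((real ?w / real b) ^ b) ^ 2 / (2 ^ Suc b * (real ?n ^ b / fact b)))"
    using w0 n0 assms(4)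
    by (simp add: \<mu>_def field_simps power_divide power_mult_distrib flip: power_mult)
  also have "\<dots> \<le> \<mu> ^ b * (real (?w choose b) ^ 2 / (2 ^ Suc b * real (?n choose b)))"
  proof (rule mult_left_mono, rule frac_le)
    show "((real ?w / real b) ^ b) ^ 2 \<le> real (?w choose b) ^ 2"
      by (intro power_mono) (use binomial_ge_n_over_k_pow_k[OF assms(5), where 'a = real] in auto)
    have "real ((?n choose b) * fact b) \<le> real (?n ^ b)"
      unfolding of_nat_le_iff by (rule binomial_fact_pow)
    thus "2 ^ Suc b * real (?n choose b) \<le> 2 ^ Suc b * (real ?n ^ b / fact b)"
      by (simp add: field_simps)
  qed (use b \<mu> in auto)
  also have "\<dots> \<le> \<mu> ^ b * (\<Sum>M\<in>?S. p M)"
    using \<mu> assms by (intro mult_left_mono sum_p_ge) auto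
  finally show ?thesis using main by linarith
qed

end

section \<open>The price of the tilts\<close>

text \<open>This is the product of \<open>(1 + a / i)\<^sup>2\<close> over \<open>i = 1, \<dots>, w\<close>.\<close>

definition cost :: "nat \<Rightarrow> nat \<Rightarrow> real" where
  "cost a w = real ((a + w) choose w) ^ 2"

lemma cost_pos: "cost a w > 0"
  by (simp add: cost_def)

lemma cost_ge_1: "cost a w \<ge> 1"
proof -
  have "real ((a + w) choose w) \<ge> 1"
    using zero_less_binomial[of w "a + w"] by (simp add: Suc_le_eq)
  thus ?thesis by (simp add: cost_def one_le_power)
qed

lemma cost_le: "cost a w \<le> 2 ^ (2 * (a + w))"
proof -
  have "real ((a + w) choose w) \<le> real (2 ^ (a + w))"
    unfolding of_nat_le_iff by (rule binomial_le_pow2)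
  hence "cost a w \<le> real (2 ^ (a + w)) ^ 2"
    unfolding cost_def by (intro power_mono) auto
  thus ?thesis by (simp add: power_mult mult.commute[of 2] flip: power_mult)
qed

text \<open>Shrinking w to w - c drops the factors with index i from w - c + 1 to w, and each is at
  least (1 + a/w)^2.\<close>

lemma cost_diff_le:
  assumes "c \<le> w"
  shows "cost a (w - c) * ((1 + real a / real w) ^ 2) ^ c \<le> cost a w"
proof -
  have "real ((a + (w - c)) choose (w - c)) * (1 + real a / real w) ^ c \<le> real ((a + w) choose w)"
    using assms
  proof (induction c)
    case (Suc c)
    define m where "m = w - Suc c"
    have m: "w - c = Suc m" "Suc m \<le> w" using Suc.prems by (auto simp: m_def)
    have "(1 + real a / real w) * real ((a + m) choose m)
        \<le> (1 + real a / real (Suc m)) * real ((a + m) choose m)"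
      using m(2) by (intro mult_right_mono add_left_mono divide_left_mono) auto
    also have "\<dots> = real ((a + Suc m) choose Suc m)"
    proof -
      have "real (Suc m) * real (Suc (a + m) choose Suc m) = real (Suc (a + m)) * real ((a + m) choose m)"
        using Suc_times_binomial[of m "a + m"] by (metis of_nat_mult)
      thus ?thesis by (simp add: field_simps)
    qed
    finally have step: "(1 + real a / real w) * real ((a + m) choose m) \<le> real ((a + Suc m) choose Suc m)" .
    have "real ((a + m) choose m) * (1 + real a / real w) ^ Suc c
        = (1 + real a / real w) * real ((a + m) choose m) * (1 + real a / real w) ^ c"
      by simp
    also have "\<dots> \<le> real ((a + Suc m) choose Suc m) * (1 + real a / real w) ^ c"
      by (rule mult_right_mono[OF step]) simp
    also have "\<dots> \<le> real ((a + w) choose w)"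
      using Suc.IH Suc.prems m(1) by simp
    finally show ?case by (simp add: m_def)
  qed simp
  hence "(real ((a + (w - c)) choose (w - c)) * (1 + real a / real w) ^ c) ^ 2
      \<le> real ((a + w) choose w) ^ 2"
    by (intro power_mono) auto
  thus ?thesis
    by (simp add: cost_def power_mult_distrib mult.commute flip: power_mult)
qed

lemma exp_le_powr:
  fixes x :: real
  assumes x: "x \<ge> 0"
  shows "exp x \<le> 2 powr (2 * x)"
proof -
  have "exp (1 / 2 :: real) \<le> 2"
    using exp_bound_half[of "1 / 2 :: real"] by simp
  hence "1 / 2 \<le> ln (2 :: real)" by (subst ln_ge_iff) auto
  hence "1 * x \<le> (ln 2 * 2) * x" using x by (intro mult_right_mono) auto
  thus ?thesis by (simp add: powr_def mult_ac)
qed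

lemma exp_minus_le_powr:
  fixes x :: real
  assumes "x \<ge> 0"
  shows "exp (- x) \<le> 2 powr (- x)"
  using assms ln_2_less_1 mult_left_le[of "ln 2" x] by (simp add: powr_def mult.commute)

text \<open>Multiply by (1 + w)^t, which is at least t w by Bernoulli, and use (1 - w^2)^t \<le>
  1.\<close>

lemma one_minus_power_le:
  fixes w :: real
  assumes "0 < w" "w \<le> 1" "t > 0"
  shows "(1 - w) ^ t \<le> 1 / (real t * w)"
proof -
  have "(1 - w) ^ t * (real t * w) \<le> (1 - w) ^ t * (1 + real t * w)"
    using assms by (intro mult_left_mono) auto
  also have "\<dots> \<le> (1 - w) ^ t * (1 + w) ^ t"
    using assms by (intro mult_left_mono Bernoulli_inequality) auto
  also have "\<dots> = (1 - w ^ 2) ^ t"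
    by (simp add: power_mult_distrib[symmetric] algebra_simps power2_eq_square)
  also have "\<dots> \<le> 1"
    using assms by (intro power_le_one) (auto simp: power_le_one)
  finally show ?thesis
    using assms by (simp add: field_simps)
qed

section \<open>The covering estimate\<close>

context set_family
begin

lemma mean_inverse_cost_ge:
  assumes "x \<in> F" "good x" "W \<subseteq> x" "\<rho> \<ge> 0" "real a ^ 2 \<ge> 72 * real (card V) * \<rho>"
    and W: "real (card W) > \<rho>"
  shows "exp \<rho> / cost a (card W) \<le> (\<Sum>A\<in>F. 1 / cost a (card (W - A))) / real (card F)"
proof -
  let ?w = "card W"
  define b where "b = Suc (nat \<lfloor>\<rho>\<rfloor>)"
  have WV: "W \<subseteq> V" and finW: "finite W"
    using subset_V[OF assms(1,3)] finite_subset[OF _ finite_V] by auto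
  \<comment> \<open>\<open>b\<close> is the least integer above \<rho>, so an integer size exceeding
    \<rho> is at least \<open>b\<close>.\<close>
  have b: "1 \<le> b" "b \<le> ?w"
    using W assms(4) by (auto simp: b_def) linarith
  have n0: "card V > 0" using b card_mono[OF finite_V WV] by linarith
  have "exp \<rho> \<le> 1 + (real a ^ 2 / (2 * real (card V) * real b ^ 2)) ^ b * fact b / 2"
    using n0 assms b_def by (intro exp_le_growth) auto
  also have "\<dots> \<le> (\<Sum>A\<in>F. ((1 + real a / real ?w) ^ 2) ^ card (W \<inter> A)) / real (card F)"
    using assms b by (intro mean_power_card_Int_ge) auto
  finally have "exp \<rho> / cost a ?w
      \<le> (\<Sum>A\<in>F. ((1 + real a / real ?w) ^ 2) ^ card (W \<inter> A)) / real (card F) / cost a ?w"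
    using cost_pos[of a ?w] by (intro divide_right_mono) auto
  also have "\<dots> = (\<Sum>A\<in>F. ((1 + real a / real ?w) ^ 2) ^ card (W \<inter> A) / cost a ?w) / real (card F)"
    by (simp add: sum_divide_distrib field_simps)
  also have "\<dots> \<le> (\<Sum>A\<in>F. 1 / cost a (card (W - A))) / real (card F)"
  proof (intro divide_right_mono sum_mono)
    fix A
    have c: "card (W \<inter> A) \<le> ?w" "card (W - A) = ?w - card (W \<inter> A)"
      using finW by (auto simp: card_mono card_Diff_subset_Int)
    show "((1 + real a / real ?w) ^ 2) ^ card (W \<inter> A) / cost a ?w \<le> 1 / cost a (card (W - A))"
      using cost_diff_le[OF c(1), of a] cost_pos[of a ?w] cost_pos[of a "card (W - A)"]
      by (simp add: c(2) field_simps)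
  qed simp
  finally show ?thesis .
qed

text \<open>Induction on the draws: while the remainder is larger than \<rho>, both terms in the
  bracket scale by exp \<rho> per draw. The subtracted exponential pays for running out of draws,
  making the bracket nonpositive at r = 0. Once the remainder has size at most \<rho>, a single draw
  contains it with probability at least \<alpha>.\<close>

lemma cover_prob_ge:
  assumes x: "x \<in> F" "good x" and \<rho>: "\<rho> \<ge> 0" "real a ^ 2 \<ge> 72 * real (card V) * \<rho>"
    and \<alpha>: "\<alpha> \<ge> 0" "\<And>W. W \<subseteq> x \<Longrightarrow> real (card W) \<le> \<rho> \<Longrightarrow> \<alpha> \<le> p W"
    and W: "W \<subseteq> x"
  shows "\<alpha> * (1 / cost a (card W) - exp (- \<rho> * real r)) \<le> cover_prob F (Suc r) W"
  using W
proof (induction r arbitrary: W)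
  case (0 W)
  show ?case
    using cost_ge_1[of a "card W"] cover_prob_nonneg[of F "Suc 0" W] \<alpha>(1)
    by (intro order_trans[OF mult_nonneg_nonpos]) (auto simp: cost_pos)
next
  case (Suc r W)
  show ?case
  proof (cases "real (card W) \<le> \<rho>")
    case True
    have "\<alpha> * (1 / cost a (card W) - exp (- \<rho> * real (Suc r))) \<le> \<alpha> * 1"
    proof (rule mult_left_mono)
      have "1 / cost a (card W) \<le> 1" using cost_ge_1[of a "card W"] by simp
      thus "1 / cost a (card W) - exp (- \<rho> * real (Suc r)) \<le> 1"
        using exp_gt_zero[of "- \<rho> * real (Suc r)"] by linarith
    qed (rule \<alpha>)
    also have "\<dots> \<le> p W" using \<alpha>(2)[OF Suc.prems True] by simp
    also have "\<dots> \<le> cover_prob F (Suc (Suc r)) W" by (rule p_le_cover_prob)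
    finally show ?thesis .
  next
    case False
    let ?h = "1 / cost a (card W)" and ?e = "exp (- \<rho> * real (Suc r))"
    show ?thesis
    \<comment> \<open>The factor exp \<rho> \<ge> 1 may be inserted only if the bracket is
      nonnegative; otherwise the bound is trivial.\<close>
    proof (cases "?h \<ge> ?e")
      case True
      have "\<alpha> * (?h - ?e) \<le> \<alpha> * (exp \<rho> * (?h - ?e))"
      proof (rule mult_left_mono)
        have "1 * (?h - ?e) \<le> exp \<rho> * (?h - ?e)"
          using True \<rho> by (intro mult_right_mono) auto
        thus "?h - ?e \<le> exp \<rho> * (?h - ?e)" by simp
      qed (rule \<alpha>)
      also have "exp \<rho> * (?h - ?e) = exp \<rho> / cost a (card W) - exp (- \<rho> * real r)"
        by (simp add: right_diff_distrib exp_add[symmetric] algebra_simps)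
      also have "\<alpha> * (exp \<rho> / cost a (card W) - exp (- \<rho> * real r))
          \<le> \<alpha> * ((\<Sum>A\<in>F. 1 / cost a (card (W - A))) / real (card F) - exp (- \<rho> * real r))"
        using False by (intro mult_left_mono diff_right_mono mean_inverse_cost_ge[OF x Suc.prems \<rho>] \<alpha>) auto
      also have "\<dots> = (\<Sum>A\<in>F. \<alpha> * (1 / cost a (card (W - A)) - exp (- \<rho> * real r))) / real (card F)"
        using card_F_pos
        by (simp only: sum_distrib_left[symmetric] sum_subtractf sum_constant)
           (simp add: field_simps)
      also have "\<dots> \<le> cover_prob F (Suc (Suc r)) W"
        unfolding cover_prob.simps(2)[of F "Suc r"] using Suc.prems
        by (intro divide_right_mono sum_mono Suc.IH) auto
      finally show ?thesis .
    next
      case False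
      hence "\<alpha> * (?h - ?e) \<le> 0" using \<alpha>(1) by (intro mult_nonneg_nonpos) auto
      thus ?thesis using cover_prob_nonneg order_trans by blast
    qed
  qed
qed

text \<open>1 / p W is one term of \<open>inv_sum (card W) x\<close>, so goodness bounds it. With s
  = n/t and w = |W|, the hypothesis gives w t \<le> 400 s, and the exponents add up to 803 = 401 +
  400 + 2.\<close>

lemma p_ge:
  assumes x: "x \<in> F" "good x" and W: "W \<subseteq> x" and t: "1 \<le> t" "t \<le> card V"
    and w: "real (card W) \<le> 400 * real (card V) / real t ^ 2"
  shows "2 powr (- 803 * (real (card V) / real t)) \<le> p W"
proof -
  let ?n = "card V" and ?w = "card W"
  define s where "s = real ?n / real t"
  have s: "s \<ge> 1" using t by (simp add: s_def)
  have WV: "W \<subseteq> V" and finW: "finite W"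
    using subset_V[OF assms(1,3)] finite_subset[OF _ finite_V] by auto
  have pW: "p W > 0" using p_pos x W by blast
  show ?thesis
  proof (cases "W = {}")
    case True
    have "p W = 1" using True card_F_pos by (simp add: p_def)
    moreover have "2 powr (- 803 * s) \<le> 2 powr 0" using s by (intro powr_mono) auto
    ultimately show ?thesis by (simp add: s_def)
  next
    case False
    have wn: "1 \<le> ?w" "?w \<le> ?n"
      using False finW WV finite_V card_mono by (auto simp: Suc_le_eq card_gt_0_iff)
    have pM: "p M > 0" if "M \<subseteq> x" for M using p_pos[OF x(1) that] .
    have "1 / p W = (\<Sum>M\<in>{W}. 1 / p M)" by simp
    also have "\<dots> \<le> inv_sum ?w x"
      unfolding inv_sum_def using W finite_mem[OF x(1)] pM
      by (intro sum_mono2) (auto intro: less_imp_le)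
    also have "\<dots> \<le> 2 ^ Suc ?w * real (?n choose ?w)"
      using x(2) wn by (auto simp: good_def)
    also have "\<dots> \<le> 2 powr (401 * s) * (2 powr (400 * s) * 2 powr (2 * s))"
    proof (rule mult_mono)
      have "real ?w * real t * real t \<le> 400 * real ?n"
        using w t by (simp add: field_simps power2_eq_square)
      hence wt: "real ?w * real t \<le> 400 * s"
        using t by (simp add: s_def field_simps)
      moreover have "real ?w * 1 \<le> real ?w * real t"
        using t by (intro mult_left_mono) auto
      ultimately have "real (Suc ?w) \<le> 401 * s" using s by simp
      thus "(2::real) ^ Suc ?w \<le> 2 powr (401 * s)"
        by (subst powr_realpow[symmetric]) (auto intro!: powr_mono)
      \<comment> \<open>One term of the expansion of (1 + 1/t)^n \<le> e^s gives n choose w \<le>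
        t^w e^s.\<close>
      have "real (?n choose ?w) * (1 / real t) ^ ?w * 1 ^ (?n - ?w)
          \<le> (\<Sum>k\<le>?n. real (?n choose k) * (1 / real t) ^ k * 1 ^ (?n - k))"
        using wn by (intro member_le_sum) auto
      also have "\<dots> = (1 / real t + 1) ^ ?n"
        by (subst binomial_ring) simp
      also have "\<dots> \<le> exp (1 / real t) ^ ?n"
        using exp_ge_add_one_self[of "1 / real t"] by (intro power_mono) (auto simp: add.commute)
      also have "\<dots> = exp s" by (simp add: s_def flip: exp_of_nat_mult)
      also have "\<dots> \<le> 2 powr (2 * s)" using s by (intro exp_le_powr) auto
      finally have "real (?n choose ?w) \<le> real t ^ ?w * 2 powr (2 * s)"
        using t by (simp add: field_simps power_divide)
      also have "real t ^ ?w \<le> 2 powr (400 * s)"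
      proof -
        have "real t \<le> 2 ^ t" by (rule less_imp_le[OF of_nat_less_two_power])
        hence "real t ^ ?w \<le> (2 ^ t) ^ ?w" by (intro power_mono) auto
        also have "\<dots> = 2 powr (real ?w * real t)"
          by (simp add: powr_realpow[symmetric] powr_powr mult.commute flip: power_mult of_nat_mult)
        also have "\<dots> \<le> 2 powr (400 * s)" using wt by (intro powr_mono) auto
        finally show ?thesis .
      qed
      finally show "real (?n choose ?w) \<le> 2 powr (400 * s) * 2 powr (2 * s)" by simp
    qed auto
    also have "\<dots> = 2 powr (803 * s)" by (simp flip: powr_add)
    finally have "1 \<le> 2 powr (803 * s) * p W" using pW by (simp add: field_simps)
    thus ?thesis by (simp add: s_def powr_minus field_simps)
  qed
qed

lemma cover_prob_small_ge:
  assumes x: "x \<in> F" "good x" and W: "W \<subseteq> x" and t: "1 \<le> t" "t \<le> card V"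
    and w: "real (card W) \<le> 8 * real (card V) / real t"
  shows "2 powr (- 1162 * (real (card V) / real t)) \<le> cover_prob F (Suc t) W"
proof -
  let ?n = "card V"
  define s where "s = real ?n / real t"
  define \<rho> where "\<rho> = 400 * real ?n / real t ^ 2"
  \<comment> \<open>170^2 = 28900 just exceeds 72 * 400 = 28800. The price is then at most 2^(358
    s), where 358 = 2 (171 + 8), and exp (- \<rho> t) = exp (- 400 s) is at most half of its
    inverse.\<close>
  define a where "a = nat \<lceil>170 * s\<rceil>"
  have s: "s \<ge> 1" using t by (simp add: s_def)
  have a: "170 * s \<le> real a" "real a \<le> 171 * s" using s unfolding a_def by linarith+
  have \<rho>: "\<rho> \<ge> 0" by (simp add: \<rho>_def)
  have "72 * real ?n * \<rho> = 28800 * s ^ 2"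
    by (simp add: \<rho>_def s_def power2_eq_square)
  also have "\<dots> \<le> (170 * s) ^ 2" by (simp add: power2_eq_square)
  also have "\<dots> \<le> real a ^ 2" using a s by (intro power_mono) auto
  finally have a2: "72 * real ?n * \<rho> \<le> real a ^ 2" .
  have c: "2 powr (- 358 * s) \<le> 1 / cost a (card W)"
  proof -
    have "cost a (card W) \<le> 2 powr real (2 * (a + card W))"
      by (subst powr_realpow) (use cost_le in auto)
    also have "\<dots> \<le> 2 powr (358 * s)"
      using a w by (intro powr_mono) (auto simp: s_def)
    finally show ?thesis
      using cost_pos[of a "card W"] by (simp add: powr_minus field_simps)
  qed
  have "\<rho> * real t = 400 * s" using t by (simp add: \<rho>_def s_def power2_eq_square)
  hence "exp (- \<rho> * real t) = exp (- (400 * s))" by simp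
  also have "\<dots> \<le> 2 powr (- (400 * s))" using s by (intro exp_minus_le_powr) auto
  also have "\<dots> \<le> 2 powr (- 358 * s - 1)" using s by (intro powr_mono) auto
  also have "\<dots> = 2 powr (- 358 * s) / 2" by (simp add: powr_diff)
  finally have e: "exp (- \<rho> * real t) \<le> 2 powr (- 358 * s) / 2" .
  have "2 powr (- 1162 * s) = 2 powr (- 803 * s) * 2 powr (- 359 * s)"
    by (simp flip: powr_add)
  also have "\<dots> \<le> 2 powr (- 803 * s) * 2 powr (- 358 * s - 1)"
    using s by (intro mult_left_mono powr_mono) auto
  also have "2 powr (- 358 * s - 1) = 2 powr (- 358 * s) / 2" by (simp add: powr_diff)
  also have "2 powr (- 803 * s) * (2 powr (- 358 * s) / 2)
      \<le> 2 powr (- 803 * s) * (1 / cost a (card W) - exp (- \<rho> * real t))"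
    using c e by (intro mult_left_mono) auto
  also have "\<dots> \<le> cover_prob F (Suc t) W"
  proof (rule cover_prob_ge[OF x \<rho> a2 _ _ W])
    show "2 powr (- 803 * s) \<le> p W'" if "W' \<subseteq> x" "real (card W') \<le> \<rho>" for W'
      using p_ge[OF x that(1) t] that(2) by (simp add: s_def \<rho>_def)
  qed simp
  finally show ?thesis by (simp add: s_def)
qed

text \<open>A point j of \<open>x\<close> is missed by t draws with probability (1 - p {j})^t \<le>
  1 / (t p {j}). Summing over j gives \<open>inv_sum 1 x\<close> / t, and goodness at level 1 bounds
  this by 4 n / t.\<close>

lemma sum_card_Diff_le:
  assumes x: "x \<in> F" "good x" and t: "1 \<le> t" "t \<le> card V"
  shows "(\<Sum>xs\<in>tuples F t. real (card (x - \<Union>(set xs))))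
    \<le> 4 * real (card V) / real t * real (card F) ^ t"
proof -
  have finx: "finite x" and fin: "finite (tuples F t)"
    using x finite_mem finite_lists_length_eq[OF finite_F] by auto
  have "(\<Sum>xs\<in>tuples F t. real (card (x - \<Union>(set xs))))
      = (\<Sum>xs\<in>tuples F t. \<Sum>j | j \<in> x \<and> j \<notin> \<Union>(set xs). 1)"
    by (simp add: set_diff_eq)
  also have "\<dots> = (\<Sum>j\<in>x. \<Sum>xs | xs \<in> tuples F t \<and> j \<notin> \<Union>(set xs). 1)"
    by (rule sum.swap_restrict[OF fin finx])
  also have "\<dots> \<le> (\<Sum>j\<in>x. real (card F) ^ t / real t * (1 / p {j}))"
  proof (rule sum_mono)
    fix j assume j: "j \<in> x"
    have pj: "p {j} > 0"
      using j x p_pos by simp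
    have pj': "p {j} \<le> 1"
      using finite_F card_F_pos by (auto simp: p_def intro!: card_mono)
    have "{xs. xs \<in> tuples F t \<and> j \<notin> \<Union>(set xs)} = tuples {A \<in> F. j \<notin> A} t" by auto
    hence "(\<Sum>xs | xs \<in> tuples F t \<and> j \<notin> \<Union>(set xs). 1) = real (card {A \<in> F. j \<notin> A}) ^ t"
      using card_lists_length_eq[of "{A \<in> F. j \<notin> A}" t] finite_F by simp
    also have "card {A \<in> F. {j} \<subseteq> A} + card {A \<in> F. j \<notin> A} = card F"
      using card_filter_add_card_filter_not[OF finite_F, of "\<lambda>A. j \<in> A"] by simp
    hence "real (card {A \<in> F. j \<notin> A}) = real (card F) - real (card {A \<in> F. {j} \<subseteq> A})"
      by linarith
    also have "\<dots> = real (card F) * (1 - p {j})"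
      using card_F_pos by (simp add: p_def right_diff_distrib)
    also have "(real (card F) * (1 - p {j})) ^ t \<le> real (card F) ^ t * (1 / (real t * p {j}))"
      unfolding power_mult_distrib using pj pj' t by (intro mult_left_mono one_minus_power_le) auto
    finally show "(\<Sum>xs | xs \<in> tuples F t \<and> j \<notin> \<Union>(set xs). 1) \<le> real (card F) ^ t / real t * (1 / p {j})"
      by (simp add: field_simps)
  qed
  also have "\<dots> = real (card F) ^ t / real t * inv_sum 1 x"
  proof -
    have "{M. M \<subseteq> x \<and> card M = 1} = (\<lambda>j. {j}) ` x"
      by (auto simp: card_1_singleton_iff)
    hence "inv_sum 1 x = (\<Sum>j\<in>x. 1 / p {j})"
      unfolding inv_sum_def by (simp add: sum.reindex)
    thus ?thesis by (simp add: sum_distrib_left)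
  qed
  also have "\<dots> \<le> real (card F) ^ t / real t * (4 * real (card V))"
    using x(2) t by (intro mult_left_mono) (auto simp: good_def dest!: bspec[where x = 1])
  finally show ?thesis by (simp add: field_simps)
qed

text \<open>By Markov, at least half of the t-tuples leave at most 8 n / t points of
  \<open>x\<close>, twice the mean bound; t + 1 further draws cover these.\<close>

lemma cover_prob_good_ge:
  assumes x: "x \<in> F" "good x" and t: "1 \<le> t" "t \<le> card V"
  shows "2 powr (- 1162 * (real (card V) / real t)) / 2 \<le> cover_prob F (t + Suc t) x"
proof -
  let ?N = "real (card F) ^ t" and ?\<beta> = "2 powr (- 1162 * (real (card V) / real t))"
  define k where "k = 8 * real (card V) / real t"
  let ?S = "{xs \<in> tuples F t. real (card (x - \<Union>(set xs))) \<le> k}"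
  let ?T = "{xs \<in> tuples F t. \<not> real (card (x - \<Union>(set xs))) \<le> k}"
  have fin: "finite (tuples F t)" by (rule finite_lists_length_eq[OF finite_F])
  have k: "k > 0" using t by (simp add: k_def)
  have N: "?N > 0" using card_F_pos by simp
  have "k * real (card ?T) = (\<Sum>xs\<in>?T. k)" by simp
  also have "\<dots> \<le> (\<Sum>xs\<in>?T. real (card (x - \<Union>(set xs))))"
    by (rule sum_mono) auto
  also have "\<dots> \<le> (\<Sum>xs\<in>tuples F t. real (card (x - \<Union>(set xs))))"
    by (rule sum_mono2) (use fin in auto)
  also have "\<dots> \<le> 4 * real (card V) / real t * ?N"
    by (rule sum_card_Diff_le[OF x t])
  also have "\<dots> = k * (?N / 2)" by (simp add: k_def)
  finally have "real (card ?T) \<le> ?N / 2" using k by simp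
  moreover have "real (card ?S) + real (card ?T) = ?N"
  proof -
    have "card ?S + card ?T = card (tuples F t)"
      by (rule card_filter_add_card_filter_not[OF fin])
    also have "\<dots> = card F ^ t" by (rule card_lists_length_eq[OF finite_F])
    finally show ?thesis by (simp only: of_nat_add[symmetric] of_nat_power[symmetric])
  qed
  ultimately have S: "?N / 2 \<le> real (card ?S)" by linarith
  have "?\<beta> / 2 * ?N \<le> ?\<beta> * real (card ?S)"
    using mult_left_mono[OF S, of ?\<beta>] by simp
  also have "\<dots> = (\<Sum>xs\<in>?S. ?\<beta>)" by simp
  also have "\<dots> \<le> (\<Sum>xs\<in>?S. cover_prob F (Suc t) (x - \<Union>(set xs)))"
    by (intro sum_mono cover_prob_small_ge[OF x _ t]) (auto simp: k_def)
  also have "\<dots> \<le> (\<Sum>xs\<in>tuples F t. cover_prob F (Suc t) (x - \<Union>(set xs)))"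
    by (rule sum_mono2) (use fin cover_prob_nonneg in \<open>auto simp del: cover_prob.simps\<close>)
  also have "\<dots> = cover_prob F (t + Suc t) x * ?N"
    using cover_prob_add[OF finite_F F_nonempty, of t "Suc t" x] by simp
  finally show ?thesis using N by (simp only: mult_le_cancel_right_pos)
qed

lemma sum_cover_prob_ge:
  assumes t: "1 \<le> t" "t \<le> card V"
  shows "real (card F) * 2 powr (- 1164 * (real (card V) / real t))
    \<le> (\<Sum>x\<in>F. cover_prob F (t + Suc t) x)"
proof -
  let ?\<beta> = "2 powr (- 1162 * (real (card V) / real t))"
  have s: "real (card V) / real t \<ge> 1" using t by simp
  \<comment> \<open>The extra 2 in the exponent absorbs a factor 1/4: one half for the good members,
    one half from \<open>cover_prob_good_ge\<close>.\<close>
  have "2 powr (- 1164 * (real (card V) / real t)) \<le> 2 powr (- 1162 * (real (card V) / real t) - 2)"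
    using s by (intro powr_mono) auto
  also have "\<dots> = ?\<beta> / 4" by (simp add: powr_diff)
  finally have "real (card F) * 2 powr (- 1164 * (real (card V) / real t)) \<le> real (card F) / 2 * (?\<beta> / 2)"
    using card_F_pos by simp
  also have "\<dots> \<le> real (card {x \<in> F. good x}) * (?\<beta> / 2)"
    by (intro mult_right_mono card_good_ge) auto
  also have "\<dots> = (\<Sum>x\<in>{x \<in> F. good x}. ?\<beta> / 2)" by simp
  also have "\<dots> \<le> (\<Sum>x\<in>{x \<in> F. good x}. cover_prob F (t + Suc t) x)"
    by (intro sum_mono cover_prob_good_ge t) auto
  also have "\<dots> \<le> (\<Sum>x\<in>F. cover_prob F (t + Suc t) x)"
    by (rule sum_mono2) (use finite_F cover_prob_nonneg in \<open>auto simp del: cover_prob.simps\<close>)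
  finally show ?thesis .
qed

lemma sum_card_covering_ge:
  assumes t: "1 \<le> t" "t \<le> card V"
  shows "real (card F) ^ (2 * t + 2) * 2 powr (- 1164 * (real (card V) / real t))
    \<le> (\<Sum>x\<in>F. real (card {xs \<in> tuples F (2 * t + 1). x \<subseteq> \<Union>(set xs)}))"
proof -
  let ?N = "2 * t + 1"
  have N: "t + Suc t = ?N" by simp
  have "real (card F) ^ (2 * t + 2) * 2 powr (- 1164 * (real (card V) / real t))
      = (real (card F) * 2 powr (- 1164 * (real (card V) / real t))) * real (card F) ^ ?N"
    by simp
  also have "\<dots> \<le> (\<Sum>x\<in>F. cover_prob F ?N x) * real (card F) ^ ?N"
    using sum_cover_prob_ge[OF t] unfolding N by (intro mult_right_mono) auto
  also have "\<dots> = (\<Sum>x\<in>F. real (card {xs \<in> tuples F ?N. x \<subseteq> \<Union>(set xs)}))"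
    unfolding sum_distrib_right cover_prob_eq_card[OF finite_F F_nonempty] ..
  finally show ?thesis .
qed

end

section \<open>From covering to disjoint subfamilies\<close>

lemma exists_disjoint_subfamilies:
  fixes \<A> \<B> :: "'a set set"
  assumes V: "finite V" "\<A> \<subseteq> Pow V" "\<B> \<subseteq> Pow V" "\<A> \<noteq> {}" "\<B> \<noteq> {}"
    and t: "1 \<le> t" "t \<le> card V" and \<delta>: "\<delta> > 0" "disjoint_density \<A> \<B> \<ge> \<delta>"
  shows "\<exists>\<R> \<S>. \<R> \<subseteq> \<A> \<and> \<S> \<subseteq> \<B> \<and> (\<forall>R\<in>\<R>. \<forall>S\<in>\<S>. R \<inter> S = {}) \<and>
    real (card \<R>) * real (card \<S>) \<ge>
      \<delta> ^ (2 * t + 2) * 2 powr (- 1164 * (real (card V) / real t)) * (real (card \<A>) * real (card \<B>))"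
proof (rule ccontr)
  assume contra: "\<not> ?thesis"
  let ?N = "2 * t + 1" and ?\<beta> = "2 powr (- 1164 * (real (card V) / real t))"
  define \<gamma> where "\<gamma> = \<delta> ^ (2 * t + 2) * ?\<beta>"
  define F where "F B = {A \<in> \<A>. A \<inter> B = {}}" for B
  define R where "R xs = {A \<in> \<A>. A \<subseteq> \<Union>(set xs)}" for xs
  define S where "S xs = {B \<in> \<B>. \<forall>A\<in>set xs. A \<inter> B = {}}" for xs
  have fin: "finite \<A>" "finite \<B>" using V by (meson finite_Pow_iff finite_subset)+
  have pos: "real (card \<A>) > 0" "real (card \<B>) > 0"
    using fin V by (auto simp: card_gt_0_iff)
  have finF: "finite (F B)" for B using fin by (simp add: F_def)
  have fint: "finite (tuples \<A> ?N)" by (rule finite_lists_length_eq[OF fin(1)])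

  have upper: "real (card (S xs)) * real (card (R xs)) < \<gamma> * (real (card \<A>) * real (card \<B>))" for xs
  proof (rule ccontr)
    assume "\<not> ?thesis"
    moreover have "\<forall>A\<in>R xs. \<forall>B\<in>S xs. A \<inter> B = {}" by (auto simp: R_def S_def)
    moreover have "R xs \<subseteq> \<A>" "S xs \<subseteq> \<B>" by (auto simp: R_def S_def)
    ultimately show False using contra unfolding \<gamma>_def
      by (metis linorder_not_less mult.commute)
  qed

  define T where "T = (SIGMA B:\<B>. SIGMA x:F B. {xs \<in> tuples (F B) ?N. x \<subseteq> \<Union>(set xs)})"
  txt \<open>Double counting of \<open>T\<close>: by tuples of \<open>\<A>\<close> from above, by members of \<open>\<B>\<close> from below.\<close>
  have "card T \<le> card (SIGMA xs:tuples \<A> ?N. S xs \<times> R xs)"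
  proof (rule card_inj_on_le)
    \<comment> \<open>Every entry of a tuple from \<open>F B\<close> avoids \<open>B\<close>, so
      \<open>B\<close> lies in \<open>S xs\<close>; a member \<open>x\<close> covered by the tuple
      lies in \<open>R xs\<close>.\<close>
    let ?f = "\<lambda>(B, x, xs). (xs, B, x)"
    show "inj_on ?f T" by (auto simp: inj_on_def)
    show "?f ` T \<subseteq> (SIGMA xs:tuples \<A> ?N. S xs \<times> R xs)"
      by (fastforce simp: T_def F_def R_def S_def)
    show "finite (SIGMA xs:tuples \<A> ?N. S xs \<times> R xs)"
      using fint fin by (intro finite_SigmaI) (auto simp: S_def R_def)
  qed
  also have "\<dots> = (\<Sum>xs\<in>tuples \<A> ?N. card (S xs) * card (R xs))"
    using fint fin by (subst card_SigmaI) (auto simp: S_def R_def card_cartesian_product)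
  finally have "real (card T) \<le> (\<Sum>xs\<in>tuples \<A> ?N. real (card (S xs)) * real (card (R xs)))"
    by (simp flip: of_nat_mult of_nat_sum)
  also have "\<dots> < (\<Sum>xs\<in>tuples \<A> ?N. \<gamma> * (real (card \<A>) * real (card \<B>)))"
  proof (rule sum_strict_mono[OF fint])
    obtain A where "A \<in> \<A>" using V by blast
    hence "replicate ?N A \<in> tuples \<A> ?N" by auto
    thus "tuples \<A> ?N \<noteq> {}" by blast
  qed (rule upper)
  also have "\<dots> = \<gamma> * real (card \<A>) ^ (2 * t + 2) * real (card \<B>)"
    using card_lists_length_eq[OF fin(1), of ?N] by simp
  finally have less: "real (card T) < \<gamma> * real (card \<A>) ^ (2 * t + 2) * real (card \<B>)" .

  \<comment> \<open>The mean of \<open>d\<close> over \<B> is the disjoint density. Its exponent 2t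
    + 2 counts the covered member together with the 2t + 1 entries of the tuple.\<close>
  define d where "d B = real (card (F B)) / real (card \<A>)" for B
  have "{(A, B). A \<in> \<A> \<and> B \<in> \<B> \<and> A \<inter> B = {}} = prod.swap ` (SIGMA B:\<B>. F B)"
    by (auto simp: F_def)
  hence "real (card {(A, B). A \<in> \<A> \<and> B \<in> \<B> \<and> A \<inter> B = {}}) = (\<Sum>B\<in>\<B>. real (card (F B)))"
    using fin finF by (simp add: card_image card_SigmaI)
  hence "(\<Sum>B\<in>\<B>. d B) = disjoint_density \<A> \<B> * real (card \<B>)"
    using pos by (simp add: d_def disjoint_density_def sum_divide_distrib[symmetric])
  hence dsum: "(\<Sum>B\<in>\<B>. d B) \<ge> \<delta> * real (card \<B>)"
    using \<delta> pos by (simp add: mult_right_mono)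
  have "\<gamma> * real (card \<A>) ^ (2 * t + 2) * real (card \<B>)
      = ?\<beta> * real (card \<A>) ^ (2 * t + 2) * (\<delta> ^ (2 * t + 2) * real (card \<B>))"
    by (simp add: \<gamma>_def)
  also have "\<dots> \<le> ?\<beta> * real (card \<A>) ^ (2 * t + 2) * (\<Sum>B\<in>\<B>. d B ^ (2 * t + 2))"
    by (intro mult_left_mono sum_power_ge[OF fin(2) \<delta>(1) _ dsum]) (auto simp: d_def)
  also have "\<dots> = (\<Sum>B\<in>\<B>. real (card (F B)) ^ (2 * t + 2) * ?\<beta>)"
    unfolding sum_distrib_left
  proof (rule sum.cong[OF refl])
    fix B
    have eq: "real (card \<A>) ^ (2 * t + 2) * d B ^ (2 * t + 2) = real (card (F B)) ^ (2 * t + 2)"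
      unfolding power_mult_distrib[symmetric] using pos by (simp add: d_def)
    show "?\<beta> * real (card \<A>) ^ (2 * t + 2) * d B ^ (2 * t + 2) = real (card (F B)) ^ (2 * t + 2) * ?\<beta>"
      by (subst mult.assoc, subst eq) (rule mult.commute)
  qed
  also have "\<dots> \<le> (\<Sum>B\<in>\<B>. \<Sum>x\<in>F B. real (card {xs \<in> tuples (F B) ?N. x \<subseteq> \<Union>(set xs)}))"
  proof (rule sum_mono)
    fix B
    show "real (card (F B)) ^ (2 * t + 2) * ?\<beta>
        \<le> (\<Sum>x\<in>F B. real (card {xs \<in> tuples (F B) ?N. x \<subseteq> \<Union>(set xs)}))"
    proof (cases "F B = {}")
      case False
      interpret set_family V "F B"
        using V False by unfold_locales (auto simp: F_def)
      show ?thesis by (rule sum_card_covering_ge[OF t])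
    qed simp
  qed
  also have "\<dots> = real (card T)"
  proof -
    have fintF: "finite {xs \<in> tuples (F B) ?N. x \<subseteq> \<Union>(set xs)}" for B x
      by (rule finite_subset[OF _ finite_lists_length_eq[OF finF, of B ?N]]) auto
    have "card T = (\<Sum>B\<in>\<B>. card (SIGMA x:F B. {xs \<in> tuples (F B) ?N. x \<subseteq> \<Union>(set xs)}))"
      unfolding T_def by (rule card_SigmaI[OF fin(2)]) (intro ballI finite_SigmaI finF fintF)
    also have "\<dots> = (\<Sum>B\<in>\<B>. \<Sum>x\<in>F B. card {xs \<in> tuples (F B) ?N. x \<subseteq> \<Union>(set xs)})"
      by (intro sum.cong refl card_SigmaI ballI finF fintF)
    finally have "card T = (\<Sum>B\<in>\<B>. \<Sum>x\<in>F B. card {xs \<in> tuples (F B) ?N. x \<subseteq> \<Union>(set xs)})" .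
    thus ?thesis by simp
  qed
  finally have "\<gamma> * real (card \<A>) ^ (2 * t + 2) * real (card \<B>) \<le> real (card T)" .
  thus False using less by (rule leD[THEN notE])
qed

section \<open>Choice of t and the final bound\<close>

theorem theorem1p10:
  shows "\<exists>C::real. C > 0 \<and>
    (\<forall>(n::nat) (\<A>::nat set set) (\<B>::nat set set) (\<delta>::real).
       n > 0 \<longrightarrow>
       \<A> \<subseteq> Pow {1..n} \<longrightarrow> \<B> \<subseteq> Pow {1..n} \<longrightarrow>
       \<A> \<noteq> {} \<longrightarrow> \<B> \<noteq> {} \<longrightarrow>
       0 < \<delta> \<longrightarrow> \<delta> < 1 - 1 / real n \<longrightarrow>
       disjoint_density \<A> \<B> \<ge> \<delta> \<longrightarrow>
       (\<exists>\<R> \<S>. \<R> \<subseteq> \<A> \<and> \<S> \<subseteq> \<B> \<and>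
          (\<forall>R\<in>\<R>. \<forall>S\<in>\<S>. R \<inter> S = {}) \<and>
          real (card \<R>) * real (card \<S>) \<ge>
            2 powr (- C * sqrt (real n * log 2 (1 / \<delta>))) * (real (card \<A>) * real (card \<B>))))"
\<comment> \<open>2332 = 4 + 2 * 1164: the density loss is at most 4 q in the exponent, and n/t
  \<le> 2 q.\<close>
proof (intro exI[of _ 2332] conjI allI impI)
  fix n :: nat and \<A> \<B> :: "nat set set" and \<delta> :: real
  assume n: "n > 0" and AB: "\<A> \<subseteq> Pow {1..n}" "\<B> \<subseteq> Pow {1..n}" "\<A> \<noteq> {}" "\<B> \<noteq> {}"
    and \<delta>: "0 < \<delta>" "\<delta> < 1 - 1 / real n" "disjoint_density \<A> \<B> \<ge> \<delta>"
  define L where "L = log 2 (1 / \<delta>)"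
  define q where "q = sqrt (real n * L)"
  \<comment> \<open>This is where \<delta> < 1 - 1/n enters; it yields t^2 \<le> n / L \<le> n^2,
    hence t \<le> n.\<close>
  have L: "1 / real n < L"
  proof -
    have 1: "1 / real n < 1 - \<delta>" using \<delta> by simp
    also have 2: "1 - \<delta> \<le> - ln \<delta>" using ln_le_minus_one[of \<delta>] \<delta> by simp
    also have "\<dots> \<le> - ln \<delta> / ln 2"
    proof -
      have "ln \<delta> \<le> 0" using 1 2 zero_le_divide_1_iff[of "real n"] by linarith
      hence "- ln \<delta> * ln 2 \<le> - ln \<delta>" using ln_2_less_1 by (intro mult_left_le) auto
      thus ?thesis by (simp add: field_simps)
    qed
    also have "\<dots> = L" using \<delta> by (simp add: L_def log_def ln_div)
    finally show ?thesis .
  qed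
  have L0: "L > 0" by (rule order.strict_trans[OF _ L]) (use n in simp)
  have q0: "q > 0" using n L0 by (simp add: q_def)
  have qq: "q * q = real n * L" using n L0 by (simp add: q_def)
  have fin: "finite \<A>" "finite \<B>" using AB by (meson finite_Pow_iff finite_subset finite_atLeastAtMost)+
  show "\<exists>\<R> \<S>. \<R> \<subseteq> \<A> \<and> \<S> \<subseteq> \<B> \<and>
          (\<forall>R\<in>\<R>. \<forall>S\<in>\<S>. R \<inter> S = {}) \<and>
          real (card \<R>) * real (card \<S>) \<ge>
            2 powr (- 2332 * sqrt (real n * log 2 (1 / \<delta>))) * (real (card \<A>) * real (card \<B>))"
  \<comment> \<open>For \<open>L > n\<close> a single disjoint pair suffices, as \<open>card \<A> * card \<B> \<le> 4 ^ n\<close>.\<close>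
  proof (cases "L \<le> real n")
    case True
    \<comment> \<open>q / L = sqrt (n / L) balances L t against n / t. As q / L \<ge> 1, rounding
      down loses at most a factor 2.\<close>
    define t where "t = nat \<lfloor>q / L\<rfloor>"
    have "L * L \<le> q * q" unfolding qq using True L0 by (intro mult_right_mono) auto
    hence Lq: "L \<le> q" using q0 L0 by (simp add: abs_le_square_iff[symmetric] power2_eq_square[symmetric])
    hence qL: "1 \<le> q / L" using L0 by simp
    have t1: "1 \<le> t" and tq: "real t \<le> q / L" and "q / L \<le> real t + 1"
      unfolding t_def using qL by linarith+
    hence qt: "q / L \<le> 2 * real t" by linarith
    have nt: "real n / real t \<le> 2 * q"
    proof -
      have "real n * L \<le> q * (2 * real t * L)"
        unfolding qq[symmetric] using qt L0 q0 by (intro mult_left_mono) (auto simp: field_simps)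
      hence "real n \<le> q * (2 * real t)" using L0 by (simp add: mult.assoc[symmetric])
      thus ?thesis using t1 by (simp add: field_simps)
    qed
    have tn: "t \<le> n"
    proof -
      have "real t * real t \<le> (q / L) * (q / L)" using tq by (intro mult_mono) auto
      also have "\<dots> = real n / L" using qq L0 by (simp add: field_simps)
      also have "\<dots> \<le> real n * real n"
        using L n L0 by (simp add: field_simps)
      finally show ?thesis by (simp add: abs_le_square_iff[symmetric] power2_eq_square[symmetric] flip: of_nat_mult)
    qed
    obtain R S where RS: "R \<subseteq> \<A>" "S \<subseteq> \<B>" "\<forall>A\<in>R. \<forall>B\<in>S. A \<inter> B = {}"
      "\<delta> ^ (2 * t + 2) * 2 powr (- 1164 * (real n / real t)) * (real (card \<A>) * real (card \<B>))
        \<le> real (card R) * real (card S)"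
      using exists_disjoint_subfamilies[of "{1..n}" \<A> \<B> t \<delta>] AB t1 tn \<delta> by auto
    have "\<delta> = 2 powr (- L)"
      using \<delta> by (simp add: L_def log_divide)
    hence "\<delta> ^ (2 * t + 2) = 2 powr (- L * real (2 * t + 2))"
      using \<delta> by (metis powr_powr powr_realpow)
    hence "\<delta> ^ (2 * t + 2) * 2 powr (- 1164 * (real n / real t))
        = 2 powr (- L * real (2 * t + 2) + - 1164 * (real n / real t))"
      by (simp only: powr_add)
    moreover have "- 2332 * q \<le> - L * real (2 * t + 2) + - 1164 * (real n / real t)"
    proof -
      have "L * real t \<le> q" using tq L0 by (simp add: field_simps)
      hence "L * real (2 * t + 2) \<le> 4 * q" using Lq by (simp add: algebra_simps)
      thus ?thesis using nt by simp
    qed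
    ultimately have "2 powr (- 2332 * q) \<le> \<delta> ^ (2 * t + 2) * 2 powr (- 1164 * (real n / real t))"
      by simp
    hence "2 powr (- 2332 * q) * (real (card \<A>) * real (card \<B>)) \<le> real (card R) * real (card S)"
      using RS(4) by (meson mult_right_mono of_nat_0_le_iff mult_nonneg_nonneg order_trans)
    thus ?thesis using RS unfolding q_def L_def by blast
  next
    case False
    have "{(A, B). A \<in> \<A> \<and> B \<in> \<B> \<and> A \<inter> B = {}} \<noteq> {}"
    proof
      assume empty: "{(A, B). A \<in> \<A> \<and> B \<in> \<B> \<and> A \<inter> B = {}} = {}"
      have "disjoint_density \<A> \<B> = 0"
        unfolding disjoint_density_def empty by simp
      thus False using \<delta> by simp
    qed
    then obtain A B where AB': "A \<in> \<A>" "B \<in> \<B>" "A \<inter> B = {}" by blast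
    have "real n * real n \<le> q * q" unfolding qq using False by (intro mult_left_mono) auto
    hence nq: "real n \<le> q" using q0 by (simp add: abs_le_square_iff[symmetric] power2_eq_square[symmetric])
    have c: "real (card X) \<le> 2 powr real n" if "X \<subseteq> Pow {1..n}" for X :: "nat set set"
    proof -
      have "card X \<le> 2 ^ n" using card_mono[OF _ that] by (simp add: card_Pow)
      hence "real (card X) \<le> real (2 ^ n)" by (rule of_nat_mono)
      thus ?thesis by (simp add: powr_realpow)
    qed
    have "2 powr (- 2332 * q) * (real (card \<A>) * real (card \<B>))
        \<le> 2 powr (- 2332 * q) * (2 powr real n * 2 powr real n)"
      using c AB by (intro mult_left_mono mult_mono) auto
    also have "\<dots> = 2 powr (- 2332 * q + (real n + real n))" by (simp only: powr_add)
    also have "\<dots> \<le> 2 powr 0" using nq by (intro powr_mono) auto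
    finally have "2 powr (- 2332 * q) * (real (card \<A>) * real (card \<B>)) \<le> real (card {A}) * real (card {B})"
      by simp
    thus ?thesis using AB' unfolding q_def L_def
      by (intro exI[of _ "{A}"] exI[of _ "{B}"]) auto
  qed
qed simp

end
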